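(* Let $R=\{(0,1),(0,2),(3,0),(1,1),(1,2),(2,2),(3,1),(3,2),(3,3)\}$ and $R'=\{(0,3),(1,0),(2,0),(1,1),(1,3),(2,1),(2,2),(2,3),(3,3)\}$. Then $(123,R)\sim_{jd}(132,R)$ and $(123,R')\sim_{jd}(132,R')$.
   Context: $S_n$ is the set of permutations $\pi=\pi_1\cdots\pi_n$ of $\{1,\dots,n\}$. A mesh pattern of length $k$ is a pair $(\tau,R)$ with $\tau\in S_k$ and $R\subseteq\{0,\dots,k\}\times\{0,\dots,k\}$ (the set of shaded boxes; box $(a,b)$ is the unit square with lower-left corner $(a,b)$). An occurrence of $(\tau,R)$ in $\pi\in S_n$ is a subsequence $\pi_{i_1}\cdots\pi_{i_k}$, $i_1<\dots<i_k$, order-isomorphic to $\tau$, such that, with $i_0=0$, $i_{k+1}=n+1$, with $v_1<\dots<v_k$ the values $\pi_{i_1},\dots,\pi_{i_k}$ in increasing order, and $v_0=0$, $v_{k+1}=n+1$, for each $(a,b)\in R$ there is no index $m$ with $i_a<m<i_{a+1}$ and $v_b<\pi_m<v_{b+1}$. Two mesh patterns $q_1,q_2$ are jointly equidistributed, written $q_1\sim_{jd}q_2$, if for all nonnegative integers $n,k,\ell$ the number of $\pi\in S_n$ with exactly $k$ occurrences of $q_1$ and $\ell$ occurrences of $q_2$ equals the number of $\pi\in S_n$ with exactly $\ell$ occurrences of $q_1$ and $k$ occurrences of $q_2$. *)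

theory Defs
  imports "HOL-Combinatorics.Multiset_Permutations"
begin

text \<open>
  A permutation \<open>\<pi> \<in> S\<^sub>n\<close> is its one-line word, an element of
  \<open>permutations_of_set {1..n}\<close>. Positions are numbered from 1, whereas lists are indexed from 0.
\<close>

definition entry :: "nat list \<Rightarrow> nat \<Rightarrow> nat" where
  "entry \<pi> m = \<pi> ! (m - 1)"

text \<open>A pair \<open>(\<tau>, R)\<close>; the box \<open>(a, b)\<close> is the unit square with lower-left corner \<open>(a, b)\<close>.\<close>

type_synonym mesh_pattern = "nat list \<times> (nat \<times> nat) set"

definition is_mesh_pattern :: "mesh_pattern \<Rightarrow> bool" where
  "is_mesh_pattern q \<longleftrightarrow>
     (let (\<tau>, R) = q; k = length \<tau>
      in \<tau> \<in> permutations_of_set {1..k} \<and> R \<subseteq> {0..k} \<times> {0..k})"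

lemma is_mesh_pattern_123: "is_mesh_pattern ([1,2,3], R) \<longleftrightarrow> R \<subseteq> {0..3} \<times> {0..3}"
  and is_mesh_pattern_132: "is_mesh_pattern ([1,3,2], R) \<longleftrightarrow> R \<subseteq> {0..3} \<times> {0..3}"
  by (auto simp: is_mesh_pattern_def permutations_of_set_def eval_nat_numeral)

definition order_isomorphic :: "nat list \<Rightarrow> nat list \<Rightarrow> bool" where
  "order_isomorphic xs ys \<longleftrightarrow>
     length xs = length ys \<and>
     (\<forall>s<length xs. \<forall>t<length xs. xs ! s < xs ! t \<longleftrightarrow> ys ! s < ys ! t)"

text \<open>
  An occurrence is given by its list \<open>is = [i\<^sub>1, \<dots>, i\<^sub>k]\<close> of positions. The lists \<open>I\<close> and \<open>V\<close> are
  \<open>[i\<^sub>0, i\<^sub>1, \<dots>, i\<^sub>k, i\<^bsub>k+1\<^esub>]\<close> and \<open>[v\<^sub>0, v\<^sub>1, \<dots>, v\<^sub>k, v\<^bsub>k+1\<^esub>]\<close>, with the boundary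
  values \<open>0\<close> and \<open>n + 1\<close> added at the ends, so that \<open>I ! a = i\<^sub>a\<close> and \<open>V ! b = v\<^sub>b\<close>.
\<close>

definition is_occurrence :: "mesh_pattern \<Rightarrow> nat list \<Rightarrow> nat list \<Rightarrow> bool" where
  "is_occurrence q \<pi> is \<longleftrightarrow>
     (let (\<tau>, R) = q;
          n = length \<pi>;
          w = map (entry \<pi>) is;
          I = 0 # is @ [n + 1];
          V = 0 # sort w @ [n + 1]
      in sorted_wrt (<) is \<and> set is \<subseteq> {1..n} \<and>
         order_isomorphic w \<tau> \<and>
         (\<forall>(a, b) \<in> R. \<not> (\<exists>m. I ! a < m \<and> m < I ! (a + 1) \<and>
                               V ! b < entry \<pi> m \<and> entry \<pi> m < V ! (b + 1))))"

definition occurrences :: "mesh_pattern \<Rightarrow> nat list \<Rightarrow> nat" where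
  "occurrences q \<pi> = card {is. is_occurrence q \<pi> is}"

definition jointly_equidistributed :: "mesh_pattern \<Rightarrow> mesh_pattern \<Rightarrow> bool"
    (infix "\<sim>\<^sub>j\<^sub>d" 50) where
  "q1 \<sim>\<^sub>j\<^sub>d q2 \<longleftrightarrow>
     (\<forall>n k l.
        card {\<pi> \<in> permutations_of_set {1..n}. occurrences q1 \<pi> = k \<and> occurrences q2 \<pi> = l} =
        card {\<pi> \<in> permutations_of_set {1..n}. occurrences q1 \<pi> = l \<and> occurrences q2 \<pi> = k})"

end

theory Submission
  imports Defs
begin

text \<open>
  Exchanging the values at the last two positions of an occurrence of \<open>(123, R)\<close> turns it into an
  occurrence of \<open>(132, R)\<close>, since the lines bounding the boxes stay in place. So, for
  every \<open>R\<close>, both patterns have the same total number of occurrences in \<open>S\<^sub>n\<close>.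

  Each permutation contains each of the four given patterns at most once. The shading \<open>R\<close> forces
  the last point to sit at position \<open>n\<close>, the two larger values to be consecutive, and the first
  point to carry the largest admissible value; the shading \<open>R'\<close> is the transpose of \<open>R\<close>, with
  positions and values interchanged. Two statistics with values in \<open>{0, 1}\<close> and equal sums are
  jointly equidistributed.
\<close>

section \<open>Occurrences of patterns of length three in explicit form\<close>

text \<open>The shading condition, with the grid lines \<open>I\<close> and \<open>V\<close> as free
  arguments: the sorted values can then be written out by hand, and \<open>V\<close> can stay fixed
  while the word changes.\<close>

definition empty_boxes :: "(nat \<times> nat) set \<Rightarrow> nat list \<Rightarrow> nat list \<Rightarrow> nat list \<Rightarrow> bool" where
  "empty_boxes R \<pi> I V \<longleftrightarrow>
     (\<forall>(a, b) \<in> R. \<forall>m. I ! a < m \<longrightarrow> m < I ! (a + 1) \<longrightarrow>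
        \<not> (V ! b < entry \<pi> m \<and> entry \<pi> m < V ! (b + 1)))"

lemma order_isomorphic_123_iff: "order_isomorphic [x, y, z] [1, 2, 3] \<longleftrightarrow> x < y \<and> y < z"
  by (auto simp: order_isomorphic_def All_less_Suc)

lemma order_isomorphic_132_iff: "order_isomorphic [x, y, z] [1, 3, 2] \<longleftrightarrow> x < z \<and> z < y"
  by (auto simp: order_isomorphic_def All_less_Suc)

lemma is_occurrence_iff:
  "is_occurrence (\<tau>, R) \<pi> is \<longleftrightarrow>
     sorted_wrt (<) is \<and> set is \<subseteq> {1..length \<pi>} \<and>
     order_isomorphic (map (entry \<pi>) is) \<tau> \<and>
     empty_boxes R \<pi> (0 # is @ [length \<pi> + 1])
       (0 # sort (map (entry \<pi>) is) @ [length \<pi> + 1])"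
proof -
  have "(\<forall>(a, b) \<in> R. \<not> (\<exists>m. P a m \<and> Q a m \<and> S b m \<and> T b m)) \<longleftrightarrow>
      (\<forall>(a, b) \<in> R. \<forall>m. P a m \<longrightarrow> Q a m \<longrightarrow> \<not> (S b m \<and> T b m))" for P Q S T :: "nat \<Rightarrow> nat \<Rightarrow> bool"
    by blast
  then show ?thesis
    by (simp only: is_occurrence_def Let_def prod.case empty_boxes_def)
qed

lemma is_occurrence_length:
  "is_occurrence (\<tau>, R) \<pi> is \<Longrightarrow> length is = length \<tau>"
  by (simp add: is_occurrence_iff order_isomorphic_def)

lemma is_occurrence_length_3:
  assumes "is_occurrence (\<tau>, R) \<pi> is" "length \<tau> = 3"
  obtains i j l where "is = [i, j, l]"
  using is_occurrence_length[OF assms(1)] assms(2)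
  by (auto simp: numeral_3_eq_3 length_Suc_conv)

lemma is_occurrence_123_iff:
  "is_occurrence ([1, 2, 3], R) \<pi> [i, j, l] \<longleftrightarrow>
     0 < i \<and> i < j \<and> j < l \<and> l \<le> length \<pi> \<and>
     entry \<pi> i < entry \<pi> j \<and> entry \<pi> j < entry \<pi> l \<and>
     empty_boxes R \<pi> [0, i, j, l, length \<pi> + 1]
       [0, entry \<pi> i, entry \<pi> j, entry \<pi> l, length \<pi> + 1]"
proof -
  have "sort [x, y, z] = [x, y, z]" if "x < y \<and> y < z" for x y z :: nat
    using that by simp
  moreover have "sorted_wrt (<) [i, j, l] \<and> set [i, j, l] \<subseteq> {1..length \<pi>} \<longleftrightarrow>
      0 < i \<and> i < j \<and> j < l \<and> l \<le> length \<pi>"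
    by auto
  ultimately show ?thesis
    unfolding is_occurrence_iff list.map order_isomorphic_123_iff append.simps
    by (metis append.simps)
qed

text \<open>The pattern itself fixes the sorted order of the values, so \<open>sort\<close>
  disappears. The third and fourth members of \<open>V\<close> trade places compared with the
  pattern 123, which is just what exchanging the entries at \<open>j\<close> and \<open>l\<close>
  undoes.\<close>

lemma is_occurrence_132_iff:
  "is_occurrence ([1, 3, 2], R) \<pi> [i, j, l] \<longleftrightarrow>
     0 < i \<and> i < j \<and> j < l \<and> l \<le> length \<pi> \<and>
     entry \<pi> i < entry \<pi> l \<and> entry \<pi> l < entry \<pi> j \<and>
     empty_boxes R \<pi> [0, i, j, l, length \<pi> + 1]
       [0, entry \<pi> i, entry \<pi> l, entry \<pi> j, length \<pi> + 1]"
proof -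
  have "sort [x, y, z] = [x, z, y]" if "x < z \<and> z < y" for x y z :: nat
    using that by simp
  moreover have "sorted_wrt (<) [i, j, l] \<and> set [i, j, l] \<subseteq> {1..length \<pi>} \<longleftrightarrow>
      0 < i \<and> i < j \<and> j < l \<and> l \<le> length \<pi>"
    by auto
  ultimately show ?thesis
    unfolding is_occurrence_iff list.map order_isomorphic_132_iff append.simps
    by (metis append.simps)
qed

lemma finite_is_occurrence: "finite {is. is_occurrence (\<tau>, R) \<pi> is}"
proof (rule finite_subset)
  show "{is. is_occurrence (\<tau>, R) \<pi> is}
      \<subseteq> {is. set is \<subseteq> {1..length \<pi>} \<and> length is = length \<tau>}"
    using is_occurrence_length is_occurrence_iff by blast
qed (simp add: finite_lists_length_eq)

section \<open>Permutation words as bijections from positions to values\<close>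

lemma length_permutations_of_set_upto:
  "\<pi> \<in> permutations_of_set {1..n} \<Longrightarrow> length \<pi> = n"
  by (simp add: length_finite_permutations_of_set)

lemma bij_betw_entry:
  assumes "\<pi> \<in> permutations_of_set {1..n}"
  shows "bij_betw (entry \<pi>) {1..n} {1..n}"
proof -
  have "bij_betw (\<lambda>m. m - 1) {1..n} {..<n}"
    by (rule bij_betw_byWitness[where f' = Suc]) auto
  moreover have "bij_betw ((!) \<pi>) {..<n} {1..n}"
    using assms length_permutations_of_set_upto[OF assms]
    by (intro bij_betw_nth) (simp_all add: permutations_of_set_def)
  ultimately have "bij_betw ((!) \<pi> \<circ> (\<lambda>m. m - 1)) {1..n} {1..n}"
    by (rule bij_betw_trans)
  moreover have "(!) \<pi> \<circ> (\<lambda>m. m - 1) = entry \<pi>"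
    by (simp add: fun_eq_iff entry_def)
  ultimately show ?thesis
    by metis
qed

lemma entry_eq_iff:
  assumes "\<pi> \<in> permutations_of_set {1..n}" "a \<in> {1..n}" "b \<in> {1..n}"
  shows "entry \<pi> a = entry \<pi> b \<longleftrightarrow> a = b"
  using bij_betw_imp_inj_on[OF bij_betw_entry[OF assms(1)]] assms(2,3) by (rule inj_on_eq_iff)

lemma entry_mem:
  assumes "\<pi> \<in> permutations_of_set {1..n}" "a \<in> {1..n}"
  shows "entry \<pi> a \<in> {1..n}"
  using bij_betw_entry[OF assms(1)] assms(2) by (rule bij_betw_apply)

lemma obtain_entry:
  assumes "\<pi> \<in> permutations_of_set {1..n}" "v \<in> {1..n}"
  obtains m where "m \<in> {1..n}" "entry \<pi> m = v"
proof -
  have "v \<in> entry \<pi> ` {1..n}"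
    unfolding bij_betw_imp_surj_on[OF bij_betw_entry[OF assms(1)]] by (rule assms(2))
  then show ?thesis
    using that by (elim imageE) simp
qed

lemma entry_map:
  assumes "m \<in> {1..length \<pi>}"
  shows "entry (map f \<pi>) m = f (entry \<pi> m)"
proof -
  have "m - 1 < length \<pi>"
    using assms by auto
  then show ?thesis
    by (simp only: entry_def nth_map)
qed

section \<open>Exchanging the last two values of an occurrence\<close>

text \<open>The transposition acts on values, so that the result is a permutation by composition.
  Lists are indexed from 0, hence \<open>is ! 1\<close> and \<open>is ! 2\<close> are the second and
  third positions.\<close>

definition exchange_last_two :: "nat list \<Rightarrow> nat list \<Rightarrow> nat list" where
  "exchange_last_two \<pi> is = map (transpose (entry \<pi> (is ! 1)) (entry \<pi> (is ! 2))) \<pi>"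

text \<open>As \<open>entry \<pi>\<close> is injective on positions, transposing the values found at
  \<open>j\<close> and \<open>l\<close> amounts to transposing the positions \<open>j\<close> and
  \<open>l\<close>.\<close>

lemma entry_exchange_last_two:
  assumes "\<pi> \<in> permutations_of_set {1..n}" "m \<in> {1..n}" "j \<in> {1..n}" "l \<in> {1..n}"
  shows "entry (exchange_last_two \<pi> [i, j, l]) m = entry \<pi> (transpose j l m)"
proof -
  have "m \<in> {1..length \<pi>}"
    using assms length_permutations_of_set_upto by blast
  then show ?thesis
    using entry_eq_iff[OF assms(1,2)] assms(3,4)
    by (simp add: exchange_last_two_def entry_map transpose_def del: One_nat_def atLeastAtMost_iff)
qed

lemma exchange_last_two_mem:
  assumes "\<pi> \<in> permutations_of_set {1..n}" "j \<in> {1..n}" "l \<in> {1..n}"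
  shows "exchange_last_two \<pi> [i, j, l] \<in> permutations_of_set {1..n}"
proof -
  let ?f = "transpose (entry \<pi> j) (entry \<pi> l)"
  have "?f permutes {1..n}"
    using assms by (intro permutes_swap_id entry_mem)
  then show ?thesis
    using permutes_image[OF \<open>?f permutes {1..n}\<close>] assms(1)
    by (auto simp: exchange_last_two_def permutations_of_set_def distinct_map
        intro: permutes_inj_on)
qed

lemma exchange_last_two_involutive:
  assumes "\<pi> \<in> permutations_of_set {1..n}" "j \<in> {1..n}" "l \<in> {1..n}"
  shows "exchange_last_two (exchange_last_two \<pi> [i, j, l]) [i, j, l] = \<pi>"
proof -
  have "entry (exchange_last_two \<pi> [i, j, l]) j = entry \<pi> l"
    "entry (exchange_last_two \<pi> [i, j, l]) l = entry \<pi> j"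
    using assms by (simp_all add: entry_exchange_last_two)
  then show ?thesis
    \<comment> \<open>Only the outer application is unfolded at first, so that its transposed pair
      can be rewritten to the original two values in opposite order.\<close>
    by (simp add: exchange_last_two_def[of "exchange_last_two \<pi> [i, j, l]"])
      (simp add: exchange_last_two_def comp_def transpose_commute)
qed

text \<open>Only the entries at \<open>j\<close> and \<open>l\<close> change, and these positions
  lie on grid lines, never strictly inside a column.\<close>

lemma empty_boxes_exchange_last_two:
  assumes \<pi>: "\<pi> \<in> permutations_of_set {1..n}" and R: "R \<subseteq> {0..3} \<times> {0..3}"
    and ijl: "0 < i" "i < j" "j < l" "l \<le> n"
  shows "empty_boxes R (exchange_last_two \<pi> [i, j, l]) [0, i, j, l, n + 1] V \<longleftrightarrow>
    empty_boxes R \<pi> [0, i, j, l, n + 1] V"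
proof -
  let ?I = "[0, i, j, l, n + 1]"
  have eq: "entry (exchange_last_two \<pi> [i, j, l]) m = entry \<pi> m"
    if "(a, b) \<in> R" "?I ! a < m" "m < ?I ! (a + 1)" for a b m
  proof -
    \<comment> \<open>The bound on \<open>R\<close> keeps the index \<open>a + 1\<close> inside the
      five-element list \<open>?I\<close>.\<close>
    have "a = 0 \<or> a = 1 \<or> a = 2 \<or> a = 3"
      using R that(1) by auto
    then have "m \<in> {1..n}" "m \<noteq> j" "m \<noteq> l"
      using that(2,3) ijl by auto
    then show ?thesis
      using ijl by (simp add: entry_exchange_last_two[OF \<pi>] transpose_def)
  qed
  show ?thesis
    unfolding empty_boxes_def
  proof (rule ball_cong[OF refl])
    fix x
    assume "x \<in> R"
    then obtain a b where "x = (a, b)" "(a, b) \<in> R"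
      by (cases x) auto
    with eq[of a b] show "(case x of (a, b) \<Rightarrow> \<forall>m. ?I ! a < m \<longrightarrow> m < ?I ! (a + 1) \<longrightarrow>
          \<not> (V ! b < entry (exchange_last_two \<pi> [i, j, l]) m \<and>
            entry (exchange_last_two \<pi> [i, j, l]) m < V ! (b + 1))) \<longleftrightarrow>
        (case x of (a, b) \<Rightarrow> \<forall>m. ?I ! a < m \<longrightarrow> m < ?I ! (a + 1) \<longrightarrow>
          \<not> (V ! b < entry \<pi> m \<and> entry \<pi> m < V ! (b + 1)))"
      unfolding \<open>x = (a, b)\<close> prod.case by metis
  qed
qed

text \<open>The exchanged word, read at \<open>i\<close>, \<open>l\<close>, \<open>j\<close>, has
  the values of \<open>\<pi>\<close> at \<open>i\<close>, \<open>j\<close>, \<open>l\<close>. Hence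
  the order conditions and the list \<open>V\<close> coincide literally on both sides.\<close>

lemma is_occurrence_exchange_last_two:
  assumes \<pi>: "\<pi> \<in> permutations_of_set {1..n}" and R: "R \<subseteq> {0..3} \<times> {0..3}"
    and ijl: "0 < i" "i < j" "j < l" "l \<le> n"
  shows "is_occurrence ([1, 3, 2], R) (exchange_last_two \<pi> [i, j, l]) [i, j, l] \<longleftrightarrow>
    is_occurrence ([1, 2, 3], R) \<pi> [i, j, l]"
proof -
  let ?\<sigma> = "exchange_last_two \<pi> [i, j, l]"
  have "?\<sigma> \<in> permutations_of_set {1..n}"
    using ijl by (intro exchange_last_two_mem[OF \<pi>]) auto
  then have n: "length \<pi> = n" "length ?\<sigma> = n"
    using \<pi> by (simp_all only: length_permutations_of_set_upto)
  have "entry ?\<sigma> i = entry \<pi> i" "entry ?\<sigma> j = entry \<pi> l" "entry ?\<sigma> l = entry \<pi> j"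
    using ijl by (simp_all add: entry_exchange_last_two[OF \<pi>] transpose_def)
  then show ?thesis
    unfolding is_occurrence_123_iff is_occurrence_132_iff n
    by (simp only: empty_boxes_exchange_last_two[OF assms])
qed

text \<open>Both sums count pairs of a permutation and an occurrence. The exchange keeps the
  positions and maps the two sets of pairs to each other, being its own inverse.\<close>

lemma sum_occurrences_123_eq_132:
  assumes R: "R \<subseteq> {0..3} \<times> {0..3}"
  shows "(\<Sum>\<pi>\<in>permutations_of_set {1..n}. occurrences ([1, 2, 3], R) \<pi>) =
    (\<Sum>\<pi>\<in>permutations_of_set {1..n}. occurrences ([1, 3, 2], R) \<pi>)"
proof -
  let ?S = "permutations_of_set {1..n}"
  let ?O = "\<lambda>\<tau>. SIGMA \<pi>:?S. {is. is_occurrence (\<tau>, R) \<pi> is}"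
  let ?f = "\<lambda>(\<pi>, is). (exchange_last_two \<pi> is, is)"
  have sum: "(\<Sum>\<pi>\<in>?S. occurrences (\<tau>, R) \<pi>) = card (?O \<tau>)" for \<tau>
    unfolding occurrences_def by (rule card_SigmaI[symmetric]) (auto simp: finite_is_occurrence)
  have 1: "?f x \<in> ?O [1, 3, 2] \<and> ?f (?f x) = x" if "x \<in> ?O [1, 2, 3]" for x
  proof -
    obtain \<pi> "is" where x: "x = (\<pi>, is)" "\<pi> \<in> ?S" "is_occurrence ([1, 2, 3], R) \<pi> is"
      using \<open>x \<in> ?O [1, 2, 3]\<close> by auto
    obtain i j l where "is": "is = [i, j, l]"
      using is_occurrence_length_3[OF x(3)] by auto
    have ijl: "0 < i" "i < j" "j < l" "l \<le> n"
      using x(3) length_permutations_of_set_upto[OF x(2)]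
      unfolding "is" is_occurrence_123_iff by auto
    then have jl: "j \<in> {1..n}" "l \<in> {1..n}"
      by auto
    show ?thesis
      using exchange_last_two_mem[OF x(2) jl] exchange_last_two_involutive[OF x(2) jl]
        is_occurrence_exchange_last_two[OF x(2) R ijl] x
      by (simp add: "is" del: One_nat_def)
  qed
  have 2: "?f x \<in> ?O [1, 2, 3] \<and> ?f (?f x) = x" if "x \<in> ?O [1, 3, 2]" for x
  proof -
    obtain \<pi> "is" where x: "x = (\<pi>, is)" "\<pi> \<in> ?S" "is_occurrence ([1, 3, 2], R) \<pi> is"
      using \<open>x \<in> ?O [1, 3, 2]\<close> by auto
    obtain i j l where "is": "is = [i, j, l]"
      using is_occurrence_length_3[OF x(3)] by auto
    have ijl: "0 < i" "i < j" "j < l" "l \<le> n"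
      using x(3) length_permutations_of_set_upto[OF x(2)]
      unfolding "is" is_occurrence_132_iff by auto
    then have jl: "j \<in> {1..n}" "l \<in> {1..n}"
      by auto
    \<comment> \<open>The equivalence for occurrences starts from 123, so it is applied to the
      exchanged word; a second exchange returns to \<open>\<pi>\<close>.\<close>
    note \<sigma> = exchange_last_two_mem[OF x(2) jl, of i]
    show ?thesis
      using \<sigma> exchange_last_two_involutive[OF x(2) jl]
        is_occurrence_exchange_last_two[OF \<sigma> R ijl] x
      by (simp add: "is" del: One_nat_def)
  qed
  have "bij_betw ?f (?O [1, 2, 3]) (?O [1, 3, 2])"
    by (rule bij_betw_byWitness[where f' = ?f]) (use 1 2 in blast)+
  then show ?thesis
    unfolding sum by (rule bij_betw_same_card)
qed

section \<open>Joint equidistribution of two 0/1-valued statistics\<close>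

text \<open>The sum of such a statistic counts the permutations where it equals 1. Removing those
  where both equal 1 from the two equal sums leaves the only nontrivial case, (1, 0) against (0,
  1).\<close>

lemma jointly_equidistributed_if_le_1:
  assumes le: "\<And>n \<pi>. \<pi> \<in> permutations_of_set {1..n} \<Longrightarrow> occurrences q1 \<pi> \<le> 1"
      "\<And>n \<pi>. \<pi> \<in> permutations_of_set {1..n} \<Longrightarrow> occurrences q2 \<pi> \<le> 1"
    and sum: "\<And>n. (\<Sum>\<pi>\<in>permutations_of_set {1..n}. occurrences q1 \<pi>) =
      (\<Sum>\<pi>\<in>permutations_of_set {1..n}. occurrences q2 \<pi>)"
  shows "q1 \<sim>\<^sub>j\<^sub>d q2"
  unfolding jointly_equidistributed_def
proof (intro allI)
  fix n k l :: nat
  let ?S = "permutations_of_set {1..n}"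
  let ?C = "\<lambda>k l. {\<pi> \<in> ?S. occurrences q1 \<pi> = k \<and> occurrences q2 \<pi> = l}"
  have cases: "\<forall>\<pi>\<in>?S. occurrences q1 \<pi> = 0 \<or> occurrences q1 \<pi> = 1"
      "\<forall>\<pi>\<in>?S. occurrences q2 \<pi> = 0 \<or> occurrences q2 \<pi> = 1"
    using le by (auto simp: le_Suc_eq)
  have sum_card: "sum f ?S = card {\<pi> \<in> ?S. f \<pi> = 1}"
    if "\<forall>\<pi>\<in>?S. f \<pi> = 0 \<or> f \<pi> = 1" for f :: "nat list \<Rightarrow> nat"
  proof -
    have "sum f ?S = (\<Sum>\<pi>\<in>?S. of_bool (f \<pi> = 1))"
      using that by (intro sum.cong) auto
    then show ?thesis
      by (simp add: Int_def)
  qed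
  have "{\<pi> \<in> ?S. occurrences q1 \<pi> = 1} = ?C 1 0 \<union> ?C 1 1"
    using cases(2) by blast
  then have "sum (occurrences q1) ?S = card (?C 1 0 \<union> ?C 1 1)"
    using sum_card[OF cases(1)] by simp
  also have "\<dots> = card (?C 1 0) + card (?C 1 1)"
    by (rule card_Un_disjoint) auto
  finally have s1: "sum (occurrences q1) ?S = card (?C 1 0) + card (?C 1 1)" .
  have "{\<pi> \<in> ?S. occurrences q2 \<pi> = 1} = ?C 0 1 \<union> ?C 1 1"
    using cases(1) by blast
  then have "sum (occurrences q2) ?S = card (?C 0 1 \<union> ?C 1 1)"
    using sum_card[OF cases(2)] by simp
  also have "\<dots> = card (?C 0 1) + card (?C 1 1)"
    by (rule card_Un_disjoint) auto
  finally have swap: "card (?C 1 0) = card (?C 0 1)"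
    using s1 sum[of n] by simp
  consider "k = l" | "k = 0" "l = 1" | "k = 1" "l = 0" | "k > 1 \<or> l > 1"
    by linarith
  then show "card (?C k l) = card (?C l k)"
  proof cases
    case 4
    then have "?C k l = {}" "?C l k = {}"
      using cases by fastforce+
    then show ?thesis
      by (simp only:)
  qed (use swap in simp_all)
qed

section \<open>Uniqueness of the occurrence\<close>

lemma occurrences_le_1I:
  assumes "length \<tau> = 3"
    and "\<And>i j l i' j' l'. is_occurrence (\<tau>, R) \<pi> [i, j, l] \<Longrightarrow>
      is_occurrence (\<tau>, R) \<pi> [i', j', l'] \<Longrightarrow> i = i' \<and> j = j' \<and> l = l'"
  shows "occurrences (\<tau>, R) \<pi> \<le> 1"
  unfolding occurrences_def One_nat_def card_le_Suc0_iff_eq[OF finite_is_occurrence]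
proof (intro ballI)
  fix s t
  assume "s \<in> {is. is_occurrence (\<tau>, R) \<pi> is}" "t \<in> {is. is_occurrence (\<tau>, R) \<pi> is}"
  then have st: "is_occurrence (\<tau>, R) \<pi> s" "is_occurrence (\<tau>, R) \<pi> t"
    by auto
  show "s = t"
    using assms(2) st is_occurrence_length_3[OF st(1) assms(1)]
      is_occurrence_length_3[OF st(2) assms(1)] by metis
qed

text \<open>Here \<open>y < z\<close> are the values at \<open>j\<close> and \<open>l\<close> in
  increasing order, in whichever order they stand. One analysis of the shading thus serves both 123
  and 132.\<close>

context
  fixes \<pi> :: "nat list" and n i j l y z :: nat
  assumes \<pi>: "\<pi> \<in> permutations_of_set {1..n}"
    and ijl: "0 < i" "i < j" "j < l" "l \<le> n"
    and yz: "entry \<pi> i < y" "y < z" "{entry \<pi> j, entry \<pi> l} = {y, z}"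
begin

text \<open>A point off the occurrence lies on no horizontal grid line, so it falls inside some box
  of its column.\<close>

private lemma values_between:
  assumes "m \<in> {1..n}" "m \<noteq> i" "m \<noteq> j" "m \<noteq> l"
  shows "0 < entry \<pi> m" "entry \<pi> m < n + 1"
    "entry \<pi> m \<noteq> entry \<pi> i" "entry \<pi> m \<noteq> y" "entry \<pi> m \<noteq> z"
proof -
  show "0 < entry \<pi> m" "entry \<pi> m < n + 1"
    using entry_mem[OF \<pi> assms(1)] by auto
  have "i \<in> {1..n}" "j \<in> {1..n}" "l \<in> {1..n}"
    using ijl by auto
  then have "entry \<pi> m \<notin> {entry \<pi> i, entry \<pi> j, entry \<pi> l}"
    using assms entry_eq_iff[OF \<pi> assms(1)] by blast
  then show "entry \<pi> m \<noteq> entry \<pi> i" "entry \<pi> m \<noteq> y" "entry \<pi> m \<noteq> z"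
    using yz(3) by blast+
qed

text \<open>The three conclusions come from the fully shaded column 3, the fully shaded row 2, and
  the boxes (0,1) and (1,1), respectively.\<close>

lemma empty_boxes_R_shape:
  assumes "empty_boxes {(0,1), (0,2), (3,0), (1,1), (1,2), (2,2), (3,1), (3,2), (3,3)} \<pi>
    [0, i, j, l, n + 1] [0, entry \<pi> i, y, z, n + 1]"
  shows "l = n" and "z = y + 1"
    and "0 < m \<Longrightarrow> m < j \<Longrightarrow> \<not> (entry \<pi> i < entry \<pi> m \<and> entry \<pi> m < y)"
proof -
  have b01: "\<not> (entry \<pi> i < entry \<pi> m \<and> entry \<pi> m < y)" if "0 < m" "m < i" for m
    using assms that by (simp add: empty_boxes_def)
  have b11: "\<not> (entry \<pi> i < entry \<pi> m \<and> entry \<pi> m < y)" if "i < m" "m < j" for m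
    using assms that by (simp add: empty_boxes_def)
  have row: "\<not> (y < entry \<pi> m \<and> entry \<pi> m < z)"
    if "(0 < m \<and> m < i) \<or> (i < m \<and> m < j) \<or> (j < m \<and> m < l) \<or> (l < m \<and> m < n + 1)" for m
    using assms that by (auto simp: empty_boxes_def)
  have column: "\<not> (0 < v \<and> v < entry \<pi> i) \<and> \<not> (entry \<pi> i < v \<and> v < y) \<and>
      \<not> (y < v \<and> v < z) \<and> \<not> (z < v \<and> v < n + 1)"
    if "l < m" "m < n + 1" "v = entry \<pi> m" for m v
    using assms that by (auto simp: empty_boxes_def)
  show "l = n"
  proof (rule ccontr)
    assume "l \<noteq> n"
    \<comment> \<open>The point at position \<open>n\<close> would lie in column 3.\<close>
    then have "l < n" "n \<in> {1..n}" "n \<noteq> i" "n \<noteq> j" "n \<noteq> l"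
      using ijl by auto
    then show False
      using column[of n, OF _ _ refl] values_between[of n] by linarith
  qed
  show "z = y + 1"
  proof (rule ccontr)
    assume "z \<noteq> y + 1"
    then have z: "y + 1 < z"
      using yz by simp
    have "z \<in> {entry \<pi> j, entry \<pi> l}"
      using yz(3) by blast
    then have "z \<in> {1..n}"
      using entry_mem[OF \<pi>, of j] entry_mem[OF \<pi>, of l] ijl by auto
    \<comment> \<open>The value \<open>y + 1\<close> is below \<open>z\<close>, hence is attained;
      its point would lie in row 2.\<close>
    then have "y + 1 \<in> {1..n}"
      using z by auto
    then obtain m where m: "m \<in> {1..n}" "entry \<pi> m = y + 1"
      by (rule obtain_entry[OF \<pi>])
    have "y + 1 \<notin> {entry \<pi> i, entry \<pi> j, entry \<pi> l}"
      unfolding yz(3) using z yz(1) by auto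
    then have "m \<noteq> i" "m \<noteq> j" "m \<noteq> l"
      using m(2) by auto
    then have "(0 < m \<and> m < i) \<or> (i < m \<and> m < j) \<or> (j < m \<and> m < l) \<or> (l < m \<and> m < n + 1)"
      using m(1) unfolding atLeastAtMost_iff by linarith
    then show False
      using row[of m] m(2) z by linarith
  qed
  show "\<not> (entry \<pi> i < entry \<pi> m \<and> entry \<pi> m < y)" if "0 < m" "m < j"
    using b01[of m] b11[of m] that by (cases m i rule: linorder_cases) auto
qed

text \<open>Transposed argument: row 3 is fully shaded, then column 2, and the boxes (1,0) and (1,1)
  leave no value below \<open>y\<close> strictly between \<open>i\<close> and
  \<open>j\<close>.\<close>

lemma empty_boxes_R'_shape:
  assumes "empty_boxes {(0,3), (1,0), (2,0), (1,1), (1,3), (2,1), (2,2), (2,3), (3,3)} \<pi>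
    [0, i, j, l, n + 1] [0, entry \<pi> i, y, z, n + 1]"
  shows "z = n" and "l = j + 1"
    and "i < m \<Longrightarrow> m < j \<Longrightarrow> \<not> entry \<pi> m < y"
proof -
  have b1: "\<not> (0 < v \<and> v < entry \<pi> i) \<and> \<not> (entry \<pi> i < v \<and> v < y)"
    if "i < m" "m < j" "v = entry \<pi> m" for m v
    using assms that by (auto simp: empty_boxes_def)
  have row: "\<not> (z < entry \<pi> m \<and> entry \<pi> m < n + 1)"
    if "(0 < m \<and> m < i) \<or> (i < m \<and> m < j) \<or> (j < m \<and> m < l) \<or> (l < m \<and> m < n + 1)" for m
    using assms that by (auto simp: empty_boxes_def)
  have column: "\<not> (0 < v \<and> v < entry \<pi> i) \<and> \<not> (entry \<pi> i < v \<and> v < y) \<and>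
      \<not> (y < v \<and> v < z) \<and> \<not> (z < v \<and> v < n + 1)"
    if "j < m" "m < l" "v = entry \<pi> m" for m v
    using assms that by (auto simp: empty_boxes_def)
  show "z = n"
  proof (rule ccontr)
    assume "z \<noteq> n"
    have "z \<in> {entry \<pi> j, entry \<pi> l}"
      using yz(3) by blast
    then have "z \<in> {1..n}"
      using entry_mem[OF \<pi>, of j] entry_mem[OF \<pi>, of l] ijl by auto
    \<comment> \<open>The point with value \<open>n\<close> would lie in row 3.\<close>
    then have z: "z < n" "n \<in> {1..n}"
      using \<open>z \<noteq> n\<close> by auto
    obtain m where m: "m \<in> {1..n}" "entry \<pi> m = n"
      by (rule obtain_entry[OF \<pi> z(2)])
    have "n \<notin> {entry \<pi> i, entry \<pi> j, entry \<pi> l}"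
      unfolding yz(3) using z yz(1,2) by auto
    then have "m \<noteq> i" "m \<noteq> j" "m \<noteq> l"
      using m(2) by auto
    then have "(0 < m \<and> m < i) \<or> (i < m \<and> m < j) \<or> (j < m \<and> m < l) \<or> (l < m \<and> m < n + 1)"
      using m(1) unfolding atLeastAtMost_iff by linarith
    then show False
      using row[of m] m(2) z by linarith
  qed
  show "l = j + 1"
  proof (rule ccontr)
    assume "l \<noteq> j + 1"
    \<comment> \<open>The point at position \<open>j + 1\<close> would lie in column 2.\<close>
    then have "j < j + 1" "j + 1 < l" "j + 1 \<in> {1..n}" "j + 1 \<noteq> i" "j + 1 \<noteq> j" "j + 1 \<noteq> l"
      using ijl by auto
    then show False
      using column[of "j + 1", OF _ _ refl] values_between[of "j + 1"] by linarith
  qed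
  show "\<not> entry \<pi> m < y" if "i < m" "m < j"
  proof -
    have "m \<in> {1..n}" "m \<noteq> i" "m \<noteq> j" "m \<noteq> l"
      using that ijl by auto
    then show ?thesis
      using b1[OF that refl] values_between[of m] by linarith
  qed
qed

end

text \<open>The position \<open>l = n\<close> is known, and \<open>j\<close> is found from its
  value, one below the last entry for 123 and one above it for 132. Then \<open>i\<close> carries
  the largest value to the left of \<open>j\<close> that is below the smaller of the values at
  \<open>j\<close> and \<open>l\<close>.\<close>

lemma occurrences_R_le_1:
  assumes \<pi>: "\<pi> \<in> permutations_of_set {1..n}"
    and R: "R = {(0,1), (0,2), (3,0), (1,1), (1,2), (2,2), (3,1), (3,2), (3,3)}"
  shows "occurrences ([1, 2, 3], R) \<pi> \<le> 1" and "occurrences ([1, 3, 2], R) \<pi> \<le> 1"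
proof -
  note [simp] = length_permutations_of_set_upto[OF \<pi>] entry_eq_iff[OF \<pi>]
  have shape: "l = n \<and> entry \<pi> l = entry \<pi> j + 1 \<and> 0 < i \<and> i < j \<and> j < n \<and>
      entry \<pi> i < entry \<pi> j \<and>
      (\<forall>m. 0 < m \<and> m < j \<longrightarrow> \<not> (entry \<pi> i < entry \<pi> m \<and> entry \<pi> m < entry \<pi> j))"
    if "is_occurrence ([1, 2, 3], R) \<pi> [i, j, l]" for i j l
    using that empty_boxes_R_shape[OF \<pi>, of i j l "entry \<pi> j" "entry \<pi> l"]
    unfolding is_occurrence_123_iff R by auto
  show "occurrences ([1, 2, 3], R) \<pi> \<le> 1"
  proof (rule occurrences_le_1I)
    fix i j l i' j' l'
    assume "is_occurrence ([1, 2, 3], R) \<pi> [i, j, l]" "is_occurrence ([1, 2, 3], R) \<pi> [i', j', l']"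
    note s = this[THEN shape]
    then have jl: "l = l'" "j = j'"
      using entry_eq_iff[OF \<pi>, of j j'] by auto
    \<comment> \<open>If the values differed, the larger one would lie in the range forbidden by the
      smaller one.\<close>
    then have "entry \<pi> i = entry \<pi> i'"
      using s by (meson linorder_neqE_nat)
    then show "i = i' \<and> j = j' \<and> l = l'"
      using s jl by auto
  qed simp
  have shape: "l = n \<and> entry \<pi> j = entry \<pi> l + 1 \<and> 0 < i \<and> i < j \<and> j < n \<and>
      entry \<pi> i < entry \<pi> l \<and>
      (\<forall>m. 0 < m \<and> m < j \<longrightarrow> \<not> (entry \<pi> i < entry \<pi> m \<and> entry \<pi> m < entry \<pi> l))"
    if "is_occurrence ([1, 3, 2], R) \<pi> [i, j, l]" for i j l
    using that empty_boxes_R_shape[OF \<pi>, of i j l "entry \<pi> l" "entry \<pi> j"]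
    unfolding is_occurrence_132_iff R by auto
  show "occurrences ([1, 3, 2], R) \<pi> \<le> 1"
  proof (rule occurrences_le_1I)
    fix i j l i' j' l'
    assume "is_occurrence ([1, 3, 2], R) \<pi> [i, j, l]" "is_occurrence ([1, 3, 2], R) \<pi> [i', j', l']"
    note s = this[THEN shape]
    then have jl: "l = l'" "j = j'"
      using entry_eq_iff[OF \<pi>, of j j'] by auto
    then have "entry \<pi> i = entry \<pi> i'"
      using s by (meson linorder_neqE_nat)
    then show "i = i' \<and> j = j' \<and> l = l'"
      using s jl by auto
  qed simp
qed

text \<open>The value \<open>n\<close> locates \<open>l\<close> for 123 and \<open>j\<close> for
  132, and \<open>l = j + 1\<close> gives the other. Then \<open>i\<close> is the last position
  before \<open>j\<close> with a value below the smaller of the values at \<open>j\<close> and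
  \<open>l\<close>.\<close>

lemma occurrences_R'_le_1:
  assumes \<pi>: "\<pi> \<in> permutations_of_set {1..n}"
    and R': "R' = {(0,3), (1,0), (2,0), (1,1), (1,3), (2,1), (2,2), (2,3), (3,3)}"
  shows "occurrences ([1, 2, 3], R') \<pi> \<le> 1" and "occurrences ([1, 3, 2], R') \<pi> \<le> 1"
proof -
  note [simp] = length_permutations_of_set_upto[OF \<pi>] entry_eq_iff[OF \<pi>]
  have shape: "entry \<pi> l = n \<and> l = j + 1 \<and> 0 < i \<and> i < j \<and> l \<le> n \<and>
      entry \<pi> i < entry \<pi> j \<and> (\<forall>m. i < m \<and> m < j \<longrightarrow> \<not> entry \<pi> m < entry \<pi> j)"
    if "is_occurrence ([1, 2, 3], R') \<pi> [i, j, l]" for i j l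
    using that empty_boxes_R'_shape[OF \<pi>, of i j l "entry \<pi> j" "entry \<pi> l"]
    unfolding is_occurrence_123_iff R' by auto
  show "occurrences ([1, 2, 3], R') \<pi> \<le> 1"
  proof (rule occurrences_le_1I)
    fix i j l i' j' l'
    assume "is_occurrence ([1, 2, 3], R') \<pi> [i, j, l]" "is_occurrence ([1, 2, 3], R') \<pi> [i', j', l']"
    note s = this[THEN shape]
    then have jl: "l = l'" "j = j'"
      using entry_eq_iff[OF \<pi>, of l l'] by auto
    \<comment> \<open>If two candidates differed, the later one would lie strictly between the
      earlier one and \<open>j\<close> and have a forbidden value.\<close>
    then show "i = i' \<and> j = j' \<and> l = l'"
      using s by (meson linorder_neqE_nat)
  qed simp
  have shape: "entry \<pi> j = n \<and> l = j + 1 \<and> 0 < i \<and> i < j \<and> l \<le> n \<and>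
      entry \<pi> i < entry \<pi> l \<and> (\<forall>m. i < m \<and> m < j \<longrightarrow> \<not> entry \<pi> m < entry \<pi> l)"
    if "is_occurrence ([1, 3, 2], R') \<pi> [i, j, l]" for i j l
    using that empty_boxes_R'_shape[OF \<pi>, of i j l "entry \<pi> l" "entry \<pi> j"]
    unfolding is_occurrence_132_iff R' by auto
  show "occurrences ([1, 3, 2], R') \<pi> \<le> 1"
  proof (rule occurrences_le_1I)
    fix i j l i' j' l'
    assume "is_occurrence ([1, 3, 2], R') \<pi> [i, j, l]" "is_occurrence ([1, 3, 2], R') \<pi> [i', j', l']"
    note s = this[THEN shape]
    then have jl: "l = l'" "j = j'"
      using entry_eq_iff[OF \<pi>, of j j'] by auto
    then show "i = i' \<and> j = j' \<and> l = l'"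
      using s by (meson linorder_neqE_nat)
  qed simp
qed

theorem theorem6p1:
  fixes R R' :: "(nat \<times> nat) set"
  assumes "R = {(0,1), (0,2), (3,0), (1,1), (1,2), (2,2), (3,1), (3,2), (3,3)}"
    and "R' = {(0,3), (1,0), (2,0), (1,1), (1,3), (2,1), (2,2), (2,3), (3,3)}"
  shows "([1,2,3], R) \<sim>\<^sub>j\<^sub>d ([1,3,2], R) \<and> ([1,2,3], R') \<sim>\<^sub>j\<^sub>d ([1,3,2], R')"
proof
  have "R \<subseteq> {0..3} \<times> {0..3}" "R' \<subseteq> {0..3} \<times> {0..3}"
    unfolding assms by simp_all
  note sum = this[THEN sum_occurrences_123_eq_132]
  show "([1,2,3], R) \<sim>\<^sub>j\<^sub>d ([1,3,2], R)"
    by (intro jointly_equidistributed_if_le_1 occurrences_R_le_1[OF _ assms(1)] sum)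
  show "([1,2,3], R') \<sim>\<^sub>j\<^sub>d ([1,3,2], R')"
    by (intro jointly_equidistributed_if_le_1 occurrences_R'_le_1[OF _ assms(2)] sum)
qed

end
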